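(* For $N\in\mathbb{N}$ and $K\ge 1$, let $P(N,K)$ be the smallest number such that every complex $N\times N$ matrix $A$ with Kreiss constant less than or equal to $K$ satisfies $\|A^n\|\le P(N,K)$ for all $n\ge 1$. Given $\varepsilon>0$ and $m\in\mathbb{N}$, there exists a constant $C=C(\varepsilon,m)>0$ such that for all integers $N\ge 1$, $$P(N,1+\varepsilon)\ge C\,(\log N)^m .$$
   Context: $N\times N$ complex matrices act on $\mathbb{C}^N$ with the Euclidean norm, and $\|\cdot\|$ is the operator norm. A matrix $A$ satisfies the Kreiss resolvent condition if its spectrum is contained in $\{|z|\le 1\}$ and there is a constant $K\ge 1$ with $$\|(zI-A)^{-1}\|\le\frac{K}{|z|-1}\quad\text{for all }|z|>1;$$ the least such $K$ is called the Kreiss constant of $A$. *)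

theory Defs
  imports
    Complex_Main
    "HOL-Analysis.L2_Norm"
    "HOL-Library.Extended_Real"
    "Jordan_Normal_Form.Spectral_Radius"
    "Jordan_Normal_Form.Gauss_Jordan_Elimination"
begin

definition euclid_norm :: "complex vec \<Rightarrow> real" where
  "euclid_norm v = L2_set (\<lambda>i. cmod (vec_index v i)) {..<dim_vec v}"

definition op_norm :: "complex mat \<Rightarrow> real" where
  "op_norm A = (SUP v \<in> {v \<in> carrier_vec (dim_col A). euclid_norm v \<le> 1}. euclid_norm (A *\<^sub>v v))"

text \<open>The term \<open>the (mat_inverse B)\<close> is the two-sided inverse of \<open>B\<close> if \<open>B\<close> is invertible and
  unspecified otherwise; the resolvent is only meaningful for \<open>z\<close> outside the spectrum.\<close>

definition resolvent :: "complex mat \<Rightarrow> complex \<Rightarrow> complex mat" where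
  "resolvent A z = the (mat_inverse (z \<cdot>\<^sub>m 1\<^sub>m (dim_row A) - A))"

definition kreiss_bound :: "complex mat \<Rightarrow> real \<Rightarrow> bool" where
  "kreiss_bound A K \<longleftrightarrow> K \<ge> 1 \<and> (\<forall>z. cmod z > 1 \<longrightarrow> op_norm (resolvent A z) \<le> K / (cmod z - 1))"

definition kreiss_condition :: "complex mat \<Rightarrow> bool" where
  "kreiss_condition A \<longleftrightarrow> spectrum A \<subseteq> {z. cmod z \<le> 1} \<and> (\<exists>K. kreiss_bound A K)"

definition kreiss_constant :: "complex mat \<Rightarrow> real" where
  "kreiss_constant A = (LEAST K. kreiss_bound A K)"

text \<open>The least value of \<open>K\<close> in the definition of the Kreiss constant is attained.\<close>

lemma kreiss_constant_least:
  assumes "kreiss_condition A"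
  shows "kreiss_bound A (kreiss_constant A)"
    and "kreiss_bound A K \<Longrightarrow> kreiss_constant A \<le> K"
proof -
  define S where "S = Collect (kreiss_bound A)"
  have ne: "S \<noteq> {}" using assms unfolding S_def kreiss_condition_def by auto
  have bdd: "bdd_below S" unfolding S_def kreiss_bound_def by (rule bdd_belowI[of _ 1]) auto
  have low: "Inf S \<le> K" if "kreiss_bound A K" for K
    using that bdd by (auto simp: S_def intro: cInf_lower)
  have "1 \<le> Inf S" using ne by (rule cInf_greatest) (auto simp: S_def kreiss_bound_def)
  moreover have "op_norm (resolvent A z) \<le> Inf S / (cmod z - 1)" if "cmod z > 1" for z
  proof -
    have "op_norm (resolvent A z) * (cmod z - 1) \<le> Inf S"
      using ne that by (intro cInf_greatest) (auto simp: S_def kreiss_bound_def field_simps)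
    then show ?thesis using that by (simp add: field_simps)
  qed
  ultimately have in_S: "kreiss_bound A (Inf S)" unfolding kreiss_bound_def by blast
  have eq: "kreiss_constant A = Inf S"
    unfolding kreiss_constant_def using in_S low by (rule Least_equality)
  show "kreiss_bound A (kreiss_constant A)" using in_S by (simp add: eq)
  show "kreiss_constant A \<le> K" if "kreiss_bound A K" using low[OF that] by (simp add: eq)
qed

definition is_power_bound :: "nat \<Rightarrow> real \<Rightarrow> ereal \<Rightarrow> bool" where
  "is_power_bound N K p \<longleftrightarrow>
    (\<forall>A \<in> carrier_mat N N. kreiss_condition A \<and> kreiss_constant A \<le> K \<longrightarrow>
      (\<forall>n\<ge>1. ereal (op_norm (A ^\<^sub>m n)) \<le> p))"

text \<open>The smallest bound is taken in the extended reals, so that it exists by completeness. By the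
  Kreiss matrix theorem it is at most \<open>exp 1 * N * K\<close>, hence it is the smallest real bound
  whenever \<open>N \<ge> 1\<close> and \<open>K \<ge> 1\<close>.\<close>

definition power_bound :: "nat \<Rightarrow> real \<Rightarrow> ereal" where
  "power_bound N K = (LEAST p. is_power_bound N K p)"

lemma power_bound_least:
  shows "is_power_bound N K (power_bound N K)"
    and "is_power_bound N K p \<Longrightarrow> power_bound N K \<le> p"
proof -
  have low: "Inf (Collect (is_power_bound N K)) \<le> p" if "is_power_bound N K p" for p
    using that by (auto intro: Inf_lower)
  have in_S: "is_power_bound N K (Inf (Collect (is_power_bound N K)))"
    unfolding is_power_bound_def by (auto intro!: Inf_greatest)
  have eq: "power_bound N K = Inf (Collect (is_power_bound N K))"
    unfolding power_bound_def using in_S low by (rule Least_equality)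
  show "is_power_bound N K (power_bound N K)" using in_S by (simp add: eq)
  show "power_bound N K \<le> p" if "is_power_bound N K p" using low[OF that] by (simp add: eq)
qed

end

theory Submission
  imports Defs "HOL-Analysis.Convex"
begin

text \<open>
  The lower bound comes from one nilpotent weighted shift in each dimension, and that shift even
  has powers growing like a power of \<open>N\<close>. For positive weights \<open>b\<close> let \<open>T\<close> send \<open>e\<^sub>j\<close> to
  \<open>(b\<^sub>j\<^sub>+\<^sub>1 / b\<^sub>j) e\<^sub>j\<^sub>+\<^sub>1\<close>, so that \<open>T\<^sup>n e\<^sub>0 = (b\<^sub>n / b\<^sub>0) e\<^sub>n\<close>. The resolvent of \<open>T\<close> at \<open>z\<close> is lower
  triangular with entries of modulus \<open>r\<^sup>j\<^sup>-\<^sup>i\<^sup>-\<^sup>1 b\<^sub>i / b\<^sub>j\<close>, where \<open>r = \<bar>z\<bar> > 1\<close>, and it is estimated by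
  the Schur test with test vector \<open>1 / b\<close>. Column sums are then geometric and cost a factor
  \<open>1 / (r - 1)\<close>. A row sum is \<open>b\<^sub>i\<close> times the sum of \<open>r\<^sup>j\<^sup>-\<^sup>i\<^sup>-\<^sup>1 / b\<^sub>j\<^sup>2\<close> over \<open>j \<le> i\<close>; the first
  factor increases with \<open>j\<close> and the second decreases, so the Chebyshev sum inequality
  separates them, leaving the geometric sum and the mean of \<open>1 / b\<^sub>j\<^sup>2\<close> over \<open>j \<le> i\<close>. If this mean
  is at most \<open>K\<^sup>2 / b\<^sub>i\<^sup>2\<close> (a discrete one-sided Muckenhoupt condition \<open>A\<^sub>1\<close>), the Kreiss constant
  of \<open>T\<close> is at most \<open>K\<close> (lemma \<open>shift_kreiss_bound\<close>).

  For \<open>b\<^sub>j = (j + 1)\<^sup>s\<^sup>/\<^sup>2\<close> with \<open>0 < s < 1\<close> the condition holds with \<open>K\<^sup>2 = 1 / (1 - s)\<close>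
  (lemma \<open>sum_powr_neg_le\<close>). This constant tends to \<open>1\<close> as \<open>s\<close> tends to \<open>0\<close>, while the norm of
  \<open>T\<^sup>N\<^sup>-\<^sup>1\<close> is at least \<open>N\<^sup>s\<^sup>/\<^sup>2\<close> (lemma \<open>power_bound_ge_powr\<close>), which beats every power of \<open>log N\<close>.
\<close>

section \<open>The Schur test and the operator norm\<close>

lemma euclid_norm_square: "(euclid_norm v)\<^sup>2 = (\<Sum>i<dim_vec v. (cmod (v $ i))\<^sup>2)"
  by (simp add: euclid_norm_def L2_set_def sum_nonneg)

lemma euclid_norm_nonneg: "0 \<le> euclid_norm v"
  by (simp add: euclid_norm_def)

lemma cmod_index_le_euclid_norm:
  assumes "i < dim_vec v"
  shows "cmod (v $ i) \<le> euclid_norm v"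
  unfolding euclid_norm_def using assms by (intro member_le_L2_set) auto

text \<open>Cauchy-Schwarz is applied to each row after splitting its entries as
  \<open>\<surd>(\<bar>M\<^sub>i\<^sub>j\<bar> p\<^sub>j) * \<surd>(\<bar>M\<^sub>i\<^sub>j\<bar> / p\<^sub>j) \<bar>v\<^sub>j\<bar>\<close>; the row bound absorbs the first factor, and the column
  bound the second one after exchanging the order of summation.\<close>

lemma schur_test:
  assumes M: "M \<in> carrier_mat n m" and v: "v \<in> carrier_vec m" and c: "0 \<le> c"
    and p: "\<And>j. j < m \<Longrightarrow> 0 < p j"
    and row: "\<And>i. i < n \<Longrightarrow> (\<Sum>j<m. cmod (M $$ (i, j)) * p j) \<le> c * q i"
    and col: "\<And>j. j < m \<Longrightarrow> (\<Sum>i<n. cmod (M $$ (i, j)) * q i) \<le> d * p j"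
  shows "euclid_norm (M *\<^sub>v v) \<le> sqrt (c * d) * euclid_norm v"
proof -
  define a where "a i j = cmod (M $$ (i, j))" for i j
  define w where "w j = (cmod (v $ j))\<^sup>2 / p j" for j
  have w: "0 \<le> w j" if "j < m" for j using p[OF that] by (simp add: w_def)
  have entry: "(cmod ((M *\<^sub>v v) $ i))\<^sup>2 \<le> c * q i * (\<Sum>j<m. a i j * w j)" if i: "i < n" for i
  proof -
    have "(M *\<^sub>v v) $ i = (\<Sum>j<m. M $$ (i, j) * v $ j)"
      using M v i by (auto simp: scalar_prod_def lessThan_atLeast0 intro!: sum.cong)
    then have "cmod ((M *\<^sub>v v) $ i) \<le> (\<Sum>j<m. a i j * cmod (v $ j))"
      by (simp add: a_def sum_norm_le norm_mult)
    also have "\<dots> = (\<Sum>j<m. sqrt (a i j * p j) * (sqrt (a i j / p j) * cmod (v $ j)))"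
    proof (rule sum.cong[OF refl])
      fix j assume "j \<in> {..<m}"
      then have pj: "p j > 0" using p by simp
      have "sqrt (a i j * p j) * sqrt (a i j / p j) = sqrt ((a i j)\<^sup>2)"
        using pj by (simp flip: real_sqrt_mult add: power2_eq_square)
      then show "a i j * cmod (v $ j) = sqrt (a i j * p j) * (sqrt (a i j / p j) * cmod (v $ j))"
        by (simp add: a_def mult.assoc[symmetric] del: real_sqrt_mult)
    qed
    finally have "(cmod ((M *\<^sub>v v) $ i))\<^sup>2
        \<le> (\<Sum>j<m. sqrt (a i j * p j) * (sqrt (a i j / p j) * cmod (v $ j)))\<^sup>2"
      by (rule power_mono) simp
    also have "\<dots> \<le> (\<Sum>j<m. (sqrt (a i j * p j))\<^sup>2) * (\<Sum>j<m. (sqrt (a i j / p j) * cmod (v $ j))\<^sup>2)"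
      by (rule Cauchy_Schwarz_ineq_sum)
    also have "(\<Sum>j<m. (sqrt (a i j * p j))\<^sup>2) = (\<Sum>j<m. a i j * p j)"
      using p by (intro sum.cong) (auto simp: a_def less_imp_le)
    also have "(\<Sum>j<m. (sqrt (a i j / p j) * cmod (v $ j))\<^sup>2) = (\<Sum>j<m. a i j * w j)"
      using p by (intro sum.cong) (auto simp: a_def w_def power_mult_distrib less_imp_le)
    also have "(\<Sum>j<m. a i j * p j) * (\<Sum>j<m. a i j * w j) \<le> c * q i * (\<Sum>j<m. a i j * w j)"
      using row[OF i] w by (intro mult_right_mono sum_nonneg) (auto simp: a_def)
    finally show ?thesis .
  qed
  have "(euclid_norm (M *\<^sub>v v))\<^sup>2 = (\<Sum>i<n. (cmod ((M *\<^sub>v v) $ i))\<^sup>2)"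
    using M by (simp add: euclid_norm_square)
  also have "\<dots> \<le> (\<Sum>i<n. c * q i * (\<Sum>j<m. a i j * w j))"
    by (intro sum_mono) (use entry in auto)
  also have "\<dots> = (\<Sum>i<n. \<Sum>j<m. c * w j * (a i j * q i))"
    by (simp add: sum_distrib_left mult_ac)
  also have "\<dots> = (\<Sum>j<m. c * w j * (\<Sum>i<n. a i j * q i))"
    by (subst sum.swap) (simp add: sum_distrib_left)
  also have "\<dots> \<le> (\<Sum>j<m. c * w j * (d * p j))"
    using c w col by (intro sum_mono mult_left_mono) (auto simp: a_def)
  also have "\<dots> = (\<Sum>j<m. c * d * (cmod (v $ j))\<^sup>2)"
  proof (rule sum.cong[OF refl])
    fix j assume "j \<in> {..<m}"
    then have "p j \<noteq> 0" using p by (metis lessThan_iff less_irrefl)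
    then show "c * w j * (d * p j) = c * d * (cmod (v $ j))\<^sup>2" by (simp add: w_def)
  qed
  also have "\<dots> = c * d * (euclid_norm v)\<^sup>2"
    using v by (simp add: euclid_norm_square sum_distrib_left)
  finally have "euclid_norm (M *\<^sub>v v) \<le> sqrt (c * d * (euclid_norm v)\<^sup>2)"
    by (rule real_le_rsqrt)
  then show ?thesis by (simp add: real_sqrt_mult euclid_norm_nonneg)
qed

lemma op_norm_le:
  assumes c: "0 \<le> c" and bound: "\<And>v. v \<in> carrier_vec (dim_col M) \<Longrightarrow> euclid_norm (M *\<^sub>v v) \<le> c * euclid_norm v"
  shows "op_norm M \<le> c"
  unfolding op_norm_def
proof (rule cSUP_least)
  have "0\<^sub>v (dim_col M) \<in> {v \<in> carrier_vec (dim_col M). euclid_norm v \<le> 1}"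
    by (simp add: euclid_norm_def L2_set_def)
  then show "{v \<in> carrier_vec (dim_col M). euclid_norm v \<le> 1} \<noteq> {}" by blast
next
  fix v assume "v \<in> {v \<in> carrier_vec (dim_col M). euclid_norm v \<le> 1}"
  then have v: "v \<in> carrier_vec (dim_col M)" "euclid_norm v \<le> 1" by auto
  have "c * euclid_norm v \<le> c" using v(2) c by (rule mult_left_le)
  with bound[OF v(1)] show "euclid_norm (M *\<^sub>v v) \<le> c" by simp
qed

text \<open>A supremum of reals is only informative on a bounded set; boundedness follows from the
  Schur test with constant test vectors and the sum of all entries as a crude constant.\<close>

lemma cmod_entry_le_op_norm:
  assumes M: "M \<in> carrier_mat n m" and i: "i < n" and j: "j < m"
  shows "cmod (M $$ (i, j)) \<le> op_norm M"
proof -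
  define c where "c = (\<Sum>i<n. \<Sum>j<m. cmod (M $$ (i, j)))"
  have c: "0 \<le> c" unfolding c_def by (intro sum_nonneg) auto
  have "euclid_norm (M *\<^sub>v v) \<le> sqrt (c * c) * euclid_norm v" if "v \<in> carrier_vec m" for v
  proof (rule schur_test[OF M that c, where p = "\<lambda>_. 1" and q = "\<lambda>_. 1"])
    fix i assume i: "i < n"
    show "(\<Sum>j<m. cmod (M $$ (i, j)) * 1) \<le> c * 1"
      unfolding c_def mult_1_right
      using i by (intro member_le_sum[where f = "\<lambda>i. \<Sum>j<m. cmod (M $$ (i, j))"]) (auto intro: sum_nonneg)
  next
    fix j assume j: "j < m"
    show "(\<Sum>i<n. cmod (M $$ (i, j)) * 1) \<le> c * 1"
      unfolding c_def mult_1_right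
      using j by (intro sum_mono member_le_sum[where f = "\<lambda>j. cmod (M $$ (_, j))"]) auto
  qed auto
  then have bound: "euclid_norm (M *\<^sub>v v) \<le> c * euclid_norm v" if "v \<in> carrier_vec m" for v
    using that c by simp
  have "bdd_above ((\<lambda>v. euclid_norm (M *\<^sub>v v)) ` {v \<in> carrier_vec (dim_col M). euclid_norm v \<le> 1})"
  proof (rule bdd_aboveI2)
    fix v assume "v \<in> {v \<in> carrier_vec (dim_col M). euclid_norm v \<le> 1}"
    then have v: "v \<in> carrier_vec m" "euclid_norm v \<le> 1" using M by auto
    have "c * euclid_norm v \<le> c" using v(2) c by (rule mult_left_le)
    with bound[OF v(1)] show "euclid_norm (M *\<^sub>v v) \<le> c" by simp
  qed
  moreover have "euclid_norm (unit_vec m j) \<le> 1"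
  proof -
    have "(euclid_norm (unit_vec m j))\<^sup>2 = (\<Sum>k<m. if k = j then 1 else 0)"
      unfolding euclid_norm_square by (intro sum.cong) (auto simp: unit_vec_def j)
    also have "\<dots> = 1" using j by simp
    finally show ?thesis by (auto simp: power2_eq_1_iff)
  qed
  ultimately have "euclid_norm (M *\<^sub>v unit_vec m j) \<le> op_norm M"
    unfolding op_norm_def using M by (intro cSUP_upper) auto
  moreover have "cmod ((M *\<^sub>v unit_vec m j) $ i) \<le> euclid_norm (M *\<^sub>v unit_vec m j)"
    using M i by (intro cmod_index_le_euclid_norm) simp
  moreover have "(M *\<^sub>v unit_vec m j) $ i = M $$ (i, j)"
    using M i j by simp
  ultimately show ?thesis by simp
qed

section \<open>Kreiss constants from an explicit resolvent\<close>

lemma resolvent_eqI: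
  assumes A: "A \<in> carrier_mat n n" and R: "R \<in> carrier_mat n n"
    and inv: "(z \<cdot>\<^sub>m 1\<^sub>m n - A) * R = 1\<^sub>m n"
  shows "resolvent A z = R"
proof -
  define B where "B = z \<cdot>\<^sub>m 1\<^sub>m n - A"
  have B: "B \<in> carrier_mat n n" using A by (auto simp: B_def)
  have BR: "B * R = 1\<^sub>m n" using inv by (simp add: B_def)
  have RB: "R * B = 1\<^sub>m n" using mat_mult_left_right_inverse[OF B R BR] .
  have "B \<in> Units (ring_mat TYPE(complex) n undefined)"
    using B R BR RB by (auto simp: Units_def ring_mat_simps)
  then obtain S where S: "mat_inverse B = Some S"
    using mat_inverse(1)[OF B, of undefined] by (cases "mat_inverse B") auto
  then have S': "B * S = 1\<^sub>m n" "S \<in> carrier_mat n n" using mat_inverse(2)[OF B] by auto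
  have "S = (R * B) * S" using S'(2) RB by simp
  also have "\<dots> = R * (B * S)" using R B S'(2) by (rule assoc_mult_mat)
  also have "\<dots> = R" using R S'(1) by simp
  finally show ?thesis using A S by (simp add: resolvent_def B_def)
qed

lemma spectrum_subset_unit_disc:
  assumes A: "A \<in> carrier_mat n n" 
    and R: "\<And>z. cmod z > 1 \<Longrightarrow> R z \<in> carrier_mat n n"
    and inv: "\<And>z. cmod z > 1 \<Longrightarrow> (z \<cdot>\<^sub>m 1\<^sub>m n - A) * R z = 1\<^sub>m n"
  shows "spectrum A \<subseteq> {z. cmod z \<le> 1}"
proof (rule subsetI, rule ccontr)
  fix z assume "z \<in> spectrum A" and "z \<notin> {z. cmod z \<le> 1}"
  then have z: "cmod z > 1" by simp
  define B where "B = z \<cdot>\<^sub>m 1\<^sub>m n - A"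
  have B: "B \<in> carrier_mat n n" using A by (auto simp: B_def)
  have RB: "R z * B = 1\<^sub>m n"
    using mat_mult_left_right_inverse[OF B R[OF z]] inv[OF z] by (simp add: B_def)
  obtain v where v: "v \<in> carrier_vec n" "v \<noteq> 0\<^sub>v n" "A *\<^sub>v v = z \<cdot>\<^sub>v v"
    using \<open>z \<in> spectrum A\<close> A by (auto simp: spectrum_def eigenvalue_def eigenvector_def)
  have "B *\<^sub>v v = (z \<cdot>\<^sub>m 1\<^sub>m n) *\<^sub>v v - A *\<^sub>v v"
    unfolding B_def using A v by (intro minus_mult_distrib_mat_vec) auto
  also have "(z \<cdot>\<^sub>m 1\<^sub>m n) *\<^sub>v v = z \<cdot>\<^sub>v v"
    using v(1) by (intro eq_vecI) auto
  finally have "B *\<^sub>v v = 0\<^sub>v n" using v by auto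
  then have "R z *\<^sub>v (B *\<^sub>v v) = 0\<^sub>v n"
    using R[OF z] by (intro eq_vecI) (auto simp: scalar_prod_def)
  moreover have "R z *\<^sub>v (B *\<^sub>v v) = (R z * B) *\<^sub>v v"
    using R[OF z] B v(1) by (intro assoc_mult_mat_vec[symmetric])
  ultimately have "v = 0\<^sub>v n" using RB v(1) by simp
  with v(2) show False by simp
qed

lemma power_bound_ge:
  assumes A: "A \<in> carrier_mat N N" and K: "1 \<le> K"
    and R: "\<And>z. cmod z > 1 \<Longrightarrow> R z \<in> carrier_mat N N"
    and inv: "\<And>z. cmod z > 1 \<Longrightarrow> (z \<cdot>\<^sub>m 1\<^sub>m N - A) * R z = 1\<^sub>m N"
    and bound: "\<And>z. cmod z > 1 \<Longrightarrow> op_norm (R z) \<le> K / (cmod z - 1)"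
    and n: "n \<ge> 1" and ij: "i < N" "j < N"
  shows "ereal (cmod ((A ^\<^sub>m n) $$ (i, j))) \<le> power_bound N K"
proof -
  have kb: "kreiss_bound A K"
    unfolding kreiss_bound_def using K resolvent_eqI[OF A R inv] bound by simp
  then have kc: "kreiss_condition A"
    unfolding kreiss_condition_def using spectrum_subset_unit_disc[OF A R inv] by blast
  have "ereal (op_norm (A ^\<^sub>m n)) \<le> power_bound N K"
    using power_bound_least(1)[of N K] A kc kreiss_constant_least(2)[OF kc kb] n
    unfolding is_power_bound_def by blast
  moreover have "cmod ((A ^\<^sub>m n) $$ (i, j)) \<le> op_norm (A ^\<^sub>m n)"
    using A ij by (intro cmod_entry_le_op_norm) auto
  ultimately show ?thesis by (meson ereal_less_eq(3) order_trans)
qed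

section \<open>Weighted shifts\<close>

definition shift_mat :: "nat \<Rightarrow> (nat \<Rightarrow> real) \<Rightarrow> complex mat" where
  "shift_mat N b = mat N N (\<lambda>(i, j). if i = Suc j then of_real (b i / b j) else 0)"

definition shift_resolvent :: "nat \<Rightarrow> (nat \<Rightarrow> real) \<Rightarrow> complex \<Rightarrow> complex mat" where
  "shift_resolvent N b z =
    mat N N (\<lambda>(i, j). if j \<le> i then inverse z ^ Suc (i - j) * of_real (b i / b j) else 0)"

lemma shift_mat_carrier [simp]: "shift_mat N b \<in> carrier_mat N N"
  by (simp add: shift_mat_def)

lemma shift_resolvent_carrier [simp]: "shift_resolvent N b z \<in> carrier_mat N N"
  by (simp add: shift_resolvent_def)

lemma shift_mat_pow_entry:
  assumes b: "\<And>j. 0 < b j" and ij: "i < N" "j < N"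
  shows "(shift_mat N b ^\<^sub>m n) $$ (i, j) = (if i = j + n then of_real (b i / b j) else 0)"
  using ij
proof (induction n arbitrary: i j)
  case 0
  have "b i \<noteq> 0" using b[of i] by simp
  then show ?case using 0 by (auto simp: shift_mat_def one_mat_def)
next
  case (Suc n)
  have "(shift_mat N b ^\<^sub>m Suc n) $$ (i, j)
      = (\<Sum>k<N. (shift_mat N b ^\<^sub>m n) $$ (i, k) * shift_mat N b $$ (k, j))"
    using Suc.prems by (auto simp: scalar_prod_def lessThan_atLeast0 shift_mat_def intro!: sum.cong)
  also have "\<dots> = (\<Sum>k<N. if k = Suc j then (shift_mat N b ^\<^sub>m n) $$ (i, Suc j) * of_real (b (Suc j) / b j) else 0)"
    using Suc.prems by (intro sum.cong) (auto simp: shift_mat_def)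
  also have "\<dots> = (if Suc j < N then (shift_mat N b ^\<^sub>m n) $$ (i, Suc j) * of_real (b (Suc j) / b j) else 0)"
    by simp
  also have "\<dots> = (if i = j + Suc n then of_real (b i / b j) else 0)"
    using Suc.prems Suc.IH[of i "Suc j"] b[of "Suc j"] by auto
  finally show ?case .
qed

lemma shift_resolvent_inverse:
  assumes b: "\<And>j. 0 < b j" and z: "z \<noteq> 0"
  shows "(z \<cdot>\<^sub>m 1\<^sub>m N - shift_mat N b) * shift_resolvent N b z = 1\<^sub>m N"
proof (rule eq_matI)
  fix i j assume "i < dim_row (1\<^sub>m N :: complex mat)" "j < dim_col (1\<^sub>m N :: complex mat)"
  then have ij: "i < N" "j < N" by auto
  define R where "R = shift_resolvent N b z"
  have b0: "b j \<noteq> 0" for j using b[of j] by simp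
  have "((z \<cdot>\<^sub>m 1\<^sub>m N - shift_mat N b) * R) $$ (i, j)
      = (\<Sum>k<N. (z \<cdot>\<^sub>m 1\<^sub>m N - shift_mat N b) $$ (i, k) * R $$ (k, j))"
    using ij by (auto simp: R_def scalar_prod_def lessThan_atLeast0 shift_mat_def shift_resolvent_def intro!: sum.cong)
  also have "\<dots> = (\<Sum>k<N. (if k = i then z * R $$ (i, j) else 0)
      - (if i = Suc k then of_real (b i / b (i - 1)) * R $$ (i - 1, j) else 0))"
    using ij by (intro sum.cong) (auto simp: shift_mat_def)
  also have "\<dots> = z * R $$ (i, j)
      - (\<Sum>k<N. if i = Suc k then of_real (b i / b (i - 1)) * R $$ (i - 1, j) else 0)"
    using ij by (simp add: sum_subtractf)
  also have "(\<Sum>k<N. if i = Suc k then of_real (b i / b (i - 1)) * R $$ (i - 1, j) else 0)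
      = (if i = 0 then 0 else of_real (b i / b (i - 1)) * R $$ (i - 1, j))"
    using ij by (cases i) auto
  also have "z * R $$ (i, j) - (if i = 0 then 0 else of_real (b i / b (i - 1)) * R $$ (i - 1, j))
      = (if i = j then 1 else 0)"
  proof (cases "j < i")
    case True
    then have "i - j = Suc (i - 1 - j)" by simp
    then show ?thesis
      using True ij z b0 by (simp add: R_def shift_resolvent_def field_simps)
  next
    case False
    then show ?thesis
      using ij z b0[of j] by (cases "i = j") (auto simp: R_def shift_resolvent_def)
  qed
  finally show "((z \<cdot>\<^sub>m 1\<^sub>m N - shift_mat N b) * shift_resolvent N b z) $$ (i, j) = 1\<^sub>m N $$ (i, j)"
    using ij by (simp add: R_def)
qed (simp_all add: shift_mat_def shift_resolvent_def)

lemma geometric_sum_le: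
  fixes x :: real
  assumes "0 \<le> x" "x < 1"
  shows "(\<Sum>k<n. x ^ Suc k) \<le> x / (1 - x)"
proof -
  have "(\<Sum>k<n. x ^ Suc k) = x * ((1 - x ^ n) / (1 - x))"
    using assms(2) by (simp add: sum_distrib_left[symmetric] sum_gp_strict)
  also have "\<dots> \<le> x * (1 / (1 - x))"
    using assms by (intro mult_left_mono divide_right_mono) auto
  finally show ?thesis by simp
qed

lemma geometric_row_le:
  fixes x :: real
  assumes "0 \<le> x" "x < 1"
  shows "(\<Sum>j=0..<Suc i. x ^ Suc (i - j)) \<le> x / (1 - x)"
proof -
  have "(\<Sum>j=0..<Suc i. x ^ Suc (i - j)) = (\<Sum>k<Suc i. x ^ Suc k)"
    by (rule sum.reindex_bij_witness[of _ "\<lambda>k. i - k" "\<lambda>j. i - j"]) auto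
  with geometric_sum_le[OF assms, of "Suc i"] show ?thesis by (simp only:)
qed

lemma geometric_column_le:
  fixes x :: real
  assumes "0 \<le> x" "x < 1"
  shows "(\<Sum>i=j..<N. x ^ Suc (i - j)) \<le> x / (1 - x)"
proof -
  have "(\<Sum>i=j..<N. x ^ Suc (i - j)) = (\<Sum>k<N - j. x ^ Suc k)"
    by (rule sum.reindex_bij_witness[of _ "\<lambda>k. k + j" "\<lambda>i. i - j"]) auto
  with geometric_sum_le[OF assms, of "N - j"] show ?thesis by (simp only:)
qed

text \<open>Both test vectors of the Schur test are \<open>1 / b\<close>. With this choice the weights cancel
  from the column sums, which become truncated geometric series; the factor \<open>K\<^sup>2\<close> is entirely due to the rows, where hypothesis \<open>A1\<close> enters.\<close>

lemma shift_kreiss_bound: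
  assumes b: "\<And>j. 0 < b j" and mono: "mono b" and K: "0 \<le> K"
    and A1: "\<And>i. (\<Sum>j<Suc i. 1 / (b j)\<^sup>2) \<le> K\<^sup>2 * real (Suc i) / (b i)\<^sup>2"
    and z: "cmod z > 1"
  shows "op_norm (shift_resolvent N b z) \<le> K / (cmod z - 1)"
proof -
  define x where "x = inverse (cmod z)"
  define g where "g = 1 / (cmod z - 1)"
  have x: "0 \<le> x" "x < 1" using z by (auto simp: x_def inverse_less_1_iff)
  have xg: "x / (1 - x) = g" using z by (cases "z = 0") (auto simp: x_def g_def field_simps)
  have g: "0 \<le> g" using z by (simp add: g_def)
  have entry: "cmod (shift_resolvent N b z $$ (i, j)) = (if j \<le> i then x ^ Suc (i - j) * (b i / b j) else 0)"
    if "i < N" "j < N" for i j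
    using that b[of i] b[of j]
    by (simp add: shift_resolvent_def x_def norm_mult norm_power norm_inverse norm_divide)
  have row: "(\<Sum>j<N. cmod (shift_resolvent N b z $$ (i, j)) * (1 / b j)) \<le> (K\<^sup>2 * g) * (1 / b i)"
    if i: "i < N" for i
  proof -
    have cheb: "real (Suc i) * (\<Sum>j=0..<Suc i. x ^ Suc (i - j) * (1 / (b j)\<^sup>2))
        \<le> (\<Sum>j=0..<Suc i. x ^ Suc (i - j)) * (\<Sum>j=0..<Suc i. 1 / (b j)\<^sup>2)"
    proof (rule Chebyshev_sum_upper)
      fix j k :: nat assume "j \<le> k" "k < Suc i"
      then show "x ^ Suc (i - j) \<le> x ^ Suc (i - k)" using x by (intro power_decreasing) auto
      show "1 / (b k)\<^sup>2 \<le> 1 / (b j)\<^sup>2"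
        using b[of j] b[of k] monoD[OF mono \<open>j \<le> k\<close>] by (intro divide_left_mono power_mono) auto
    qed
    also have "\<dots> \<le> g * (K\<^sup>2 * real (Suc i) / (b i)\<^sup>2)"
    proof (rule mult_mono)
      show "(\<Sum>j=0..<Suc i. x ^ Suc (i - j)) \<le> g"
        using geometric_row_le[OF x, of i] by (simp only: xg)
      show "(\<Sum>j=0..<Suc i. 1 / (b j)\<^sup>2) \<le> K\<^sup>2 * real (Suc i) / (b i)\<^sup>2"
        using A1[of i] by (simp only: lessThan_atLeast0)
      show "0 \<le> (\<Sum>j=0..<Suc i. 1 / (b j)\<^sup>2)" by (rule sum_nonneg) simp
    qed (rule g)
    also have "\<dots> = real (Suc i) * (K\<^sup>2 * g / (b i)\<^sup>2)" by simp
    finally have mean: "(\<Sum>j=0..<Suc i. x ^ Suc (i - j) * (1 / (b j)\<^sup>2)) \<le> K\<^sup>2 * g / (b i)\<^sup>2"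
      by (simp only: mult_le_cancel_left_pos of_nat_0_less_iff zero_less_Suc)
    have "(\<Sum>j<N. cmod (shift_resolvent N b z $$ (i, j)) * (1 / b j))
        = (\<Sum>j=0..<Suc i. b i * (x ^ Suc (i - j) * (1 / (b j)\<^sup>2)))"
      using i by (intro sum.mono_neutral_cong_right) (auto simp: entry power2_eq_square)
    also have "\<dots> = b i * (\<Sum>j=0..<Suc i. x ^ Suc (i - j) * (1 / (b j)\<^sup>2))"
      by (rule sum_distrib_left[symmetric])
    also have "\<dots> \<le> b i * (K\<^sup>2 * g / (b i)\<^sup>2)"
      using mean b[of i] by (intro mult_left_mono) auto
    also have "\<dots> = (K\<^sup>2 * g) * (1 / b i)"
      using b[of i] by (simp add: power2_eq_square)
    finally show ?thesis .
  qed
  have col: "(\<Sum>i<N. cmod (shift_resolvent N b z $$ (i, j)) * (1 / b i)) \<le> g * (1 / b j)"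
    if j: "j < N" for j
  proof -
    have b0: "b i \<noteq> 0" for i using b[of i] by simp
    have "(\<Sum>i<N. cmod (shift_resolvent N b z $$ (i, j)) * (1 / b i))
        = (\<Sum>i=j..<N. x ^ Suc (i - j) * (1 / b j))"
      using j b0 by (intro sum.mono_neutral_cong_right) (auto simp: entry)
    also have "\<dots> = (\<Sum>i=j..<N. x ^ Suc (i - j)) * (1 / b j)"
      by (rule sum_distrib_right[symmetric])
    also have "\<dots> \<le> g * (1 / b j)"
      using geometric_column_le[OF x, of j N] b[of j] by (intro mult_right_mono) (auto simp: xg)
    finally show ?thesis .
  qed
  have "op_norm (shift_resolvent N b z) \<le> sqrt ((K\<^sup>2 * g) * g)"
  proof (rule op_norm_le)
    fix v :: "complex vec" assume "v \<in> carrier_vec (dim_col (shift_resolvent N b z))"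
    then have v: "v \<in> carrier_vec N" by (simp add: shift_resolvent_def)
    show "euclid_norm (shift_resolvent N b z *\<^sub>v v) \<le> sqrt ((K\<^sup>2 * g) * g) * euclid_norm v"
      using b g by (intro schur_test[OF shift_resolvent_carrier v _ _ row col]) auto
  qed (use g in simp)
  also have "sqrt ((K\<^sup>2 * g) * g) = sqrt ((K * g)\<^sup>2)" by (simp only: power2_eq_square mult_ac)
  also have "\<dots> = K * g" using K g by simp
  finally show ?thesis by (simp add: g_def)
qed

section \<open>Power weights\<close>

text \<open>The discrete form of \<open>\<integral>\<^sub>0\<^sup>n x\<^sup>-\<^sup>s dx = n\<^sup>1\<^sup>-\<^sup>s / (1 - s)\<close>; the induction step is the weighted
  inequality of arithmetic and geometric means for \<open>n\<close> and \<open>n + 1\<close> with weights \<open>1 - s\<close> and \<open>s\<close>.\<close>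

lemma sum_powr_neg_le:
  fixes s :: real
  assumes s: "0 < s" "s < 1"
  shows "(1 - s) * (\<Sum>j<n. real (Suc j) powr (- s)) \<le> real n powr (1 - s)"
proof (induction n)
  case 0
  then show ?case by simp
next
  case (Suc n)
  have "real n powr (1 - s) * real (Suc n) powr s \<le> (1 - s) * real n + s * real (Suc n)"
    using s by (cases "n = 0") (auto intro: Youngs_inequality_0)
  then have "real n powr (1 - s) * real (Suc n) powr s + (1 - s) \<le> real (Suc n)"
    by (simp add: algebra_simps)
  then have "(real n powr (1 - s) * real (Suc n) powr s + (1 - s)) * real (Suc n) powr (- s)
      \<le> real (Suc n) * real (Suc n) powr (- s)"
    by (rule mult_right_mono) simp
  moreover have "real (Suc n) powr s * real (Suc n) powr (- s) = 1"
    by (simp flip: powr_add)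
  moreover have "real (Suc n) * real (Suc n) powr (- s) = real (Suc n) powr (1 - s)"
    by (simp add: powr_diff powr_minus divide_inverse)
  ultimately have "real n powr (1 - s) + (1 - s) * real (Suc n) powr (- s) \<le> real (Suc n) powr (1 - s)"
    by (simp only: distrib_right mult.assoc mult_1_right)
  with Suc.IH show ?case by (simp only: sum.lessThan_Suc distrib_left)
qed

lemma power_bound_one:
  assumes "1 \<le> K"
  shows "1 \<le> power_bound 1 K"
proof -
  define R where "R z = mat 1 1 (\<lambda>_. inverse (z - 1) :: complex)" for z
  have "ereal (cmod ((1\<^sub>m 1 ^\<^sub>m 1) $$ (0, 0))) \<le> power_bound 1 K"
  proof (rule power_bound_ge[OF one_carrier_mat assms, where R = R])
    fix z :: complex assume z: "cmod z > 1"
    show R: "R z \<in> carrier_mat 1 1" by (simp add: R_def)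
    have "z \<noteq> 1" using z by auto
    then show "(z \<cdot>\<^sub>m 1\<^sub>m 1 - 1\<^sub>m 1) * R z = 1\<^sub>m 1"
      by (intro eq_matI) (auto simp: R_def scalar_prod_def)
    have le: "inverse (cmod (z - 1)) \<le> K / (cmod z - 1)"
    proof -
      have "inverse (cmod (z - 1)) \<le> inverse (cmod z - 1)"
        using z norm_triangle_ineq2[of z 1] by (intro le_imp_inverse_le) auto
      also have "\<dots> \<le> K / (cmod z - 1)"
        using z assms by (simp add: divide_simps)
      finally show ?thesis .
    qed
    have c: "0 \<le> K / (cmod z - 1)" using z assms by simp
    show "op_norm (R z) \<le> K / (cmod z - 1)"
    proof (rule op_norm_le[OF c])
      fix v :: "complex vec" assume "v \<in> carrier_vec (dim_col (R z))"
      then have v: "v \<in> carrier_vec 1" by (simp add: R_def)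
      have "euclid_norm (R z *\<^sub>v v) \<le> sqrt (K / (cmod z - 1) * (K / (cmod z - 1))) * euclid_norm v"
        using le by (intro schur_test[OF R v c, where p = "\<lambda>_. 1" and q = "\<lambda>_. 1"])
          (auto simp: R_def norm_inverse)
      then show "euclid_norm (R z *\<^sub>v v) \<le> K / (cmod z - 1) * euclid_norm v"
        using c by (simp only: real_sqrt_abs2 abs_of_nonneg)
    qed
  qed auto
  then show ?thesis by (simp add: one_ereal_def)
qed

text \<open>In dimension \<open>1\<close> every nilpotent matrix vanishes, and the identity takes the place of the shift.\<close>

lemma power_bound_ge_powr:
  fixes s K :: real
  assumes s: "0 < s" "s < 1" and K: "1 \<le> K" "1 \<le> K\<^sup>2 * (1 - s)" and N: "N \<ge> 1"
  shows "ereal (real N powr (s / 2)) \<le> power_bound N K"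
proof (cases "N = 1")
  case True
  then show ?thesis using power_bound_one[OF K(1)] by (simp add: one_ereal_def)
next
  case False
  define b where "b j = real (Suc j) powr (s / 2)" for j
  have b: "0 < b j" for j by (simp add: b_def)
  have mono: "mono b"
    using s by (intro monoI) (auto simp: b_def intro!: powr_mono2)
  have b2: "(b j)\<^sup>2 = real (Suc j) powr s" for j
    by (simp add: b_def power2_eq_square flip: powr_add)
  have A1: "(\<Sum>j<Suc i. 1 / (b j)\<^sup>2) \<le> K\<^sup>2 * real (Suc i) / (b i)\<^sup>2" for i
  proof -
    define S where "S = (\<Sum>j<Suc i. 1 / (b j)\<^sup>2)"
    have S: "S = (\<Sum>j<Suc i. real (Suc j) powr (- s))"
      unfolding S_def b2 by (intro sum.cong) (auto simp: powr_minus_divide)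
    have "S \<le> K\<^sup>2 * (1 - s) * S"
      using K(2) mult_right_mono[of 1 "K\<^sup>2 * (1 - s)" S] by (simp add: S_def sum_nonneg)
    also have "\<dots> = K\<^sup>2 * ((1 - s) * S)" by simp
    also have "\<dots> \<le> K\<^sup>2 * real (Suc i) powr (1 - s)"
      unfolding S using sum_powr_neg_le[OF s, of "Suc i"] by (intro mult_left_mono) auto
    also have "\<dots> = K\<^sup>2 * real (Suc i) / (b i)\<^sup>2"
      by (simp add: b2 powr_diff)
    finally show ?thesis by (simp add: S_def)
  qed
  have "ereal (cmod ((shift_mat N b ^\<^sub>m (N - 1)) $$ (N - 1, 0))) \<le> power_bound N K"
  proof (rule power_bound_ge[OF shift_mat_carrier K(1), where R = "shift_resolvent N b"])
    fix z :: complex assume z: "cmod z > 1"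
    then have "z \<noteq> 0" by auto
    then show "(z \<cdot>\<^sub>m 1\<^sub>m N - shift_mat N b) * shift_resolvent N b z = 1\<^sub>m N"
      using b by (intro shift_resolvent_inverse)
    show "op_norm (shift_resolvent N b z) \<le> K / (cmod z - 1)"
      using K(1) by (intro shift_kreiss_bound b mono A1 z) simp
  qed (use N False in auto)
  moreover have "(shift_mat N b ^\<^sub>m (N - 1)) $$ (N - 1, 0) = of_real (b (N - 1) / b 0)"
    using N by (subst shift_mat_pow_entry[OF b]) auto
  moreover have "b (N - 1) / b 0 = real N powr (s / 2)"
    using N by (simp add: b_def)
  ultimately show ?thesis by (simp only: norm_of_real abs_of_nonneg powr_ge_zero)
qed

theorem mainTheorem2:
  fixes \<epsilon> :: real and m :: nat
  assumes "\<epsilon> > 0"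
  shows "\<exists>C::real. C > 0 \<and>
    (\<forall>N::nat. N \<ge> 1 \<longrightarrow> power_bound N (1 + \<epsilon>) \<ge> ereal (C * ln (real N) ^ m))"
proof -
  \<comment> \<open>This \<open>s\<close> solves \<open>1 / (1 - s) = 1 + \<epsilon>\<close>, and \<open>t\<close> is small enough that \<open>(N\<^sup>t)\<^sup>m \<le> N\<^sup>s\<^sup>/\<^sup>2\<close>.\<close>
  define s where "s = \<epsilon> / (1 + \<epsilon>)"
  define t where "t = s / (2 * real (Suc m))"
  have s: "0 < s" "s < 1" using assms by (auto simp: s_def)
  have t: "0 < t" using s by (simp add: t_def)
  have "(1 + \<epsilon>)\<^sup>2 * (1 - s) = 1 + \<epsilon>"
    using assms by (simp add: s_def field_simps power2_eq_square)
  then have K: "1 \<le> (1 + \<epsilon>)\<^sup>2 * (1 - s)" using assms by simp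
  have "ereal (t ^ m * ln (real N) ^ m) \<le> power_bound N (1 + \<epsilon>)" if N: "N \<ge> 1" for N
  proof -
    have "t * ln (real N) \<le> real N powr t"
      using ln_powr_bound[of "real N" t] N t by (simp add: field_simps)
    then have "(t * ln (real N)) ^ m \<le> (real N powr t) ^ m"
      using N t by (intro power_mono) auto
    also have "\<dots> = real N powr (t * real m)"
      using N by (simp add: powr_power mult.commute)
    also have "\<dots> \<le> real N powr (s / 2)"
    proof (rule powr_mono)
      have "t * real m \<le> t * real (Suc m)" using t by (intro mult_left_mono) auto
      also have "\<dots> = s / 2" unfolding t_def by (simp del: of_nat_Suc)
      finally show "t * real m \<le> s / 2" .
    qed (use N in simp)
    finally have "ereal (t ^ m * ln (real N) ^ m) \<le> ereal (real N powr (s / 2))"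
      by (simp add: power_mult_distrib)
    also have "\<dots> \<le> power_bound N (1 + \<epsilon>)"
      using s K N assms by (intro power_bound_ge_powr) auto
    finally show ?thesis .
  qed
  then show ?thesis using t by (intro exI[of _ "t ^ m"]) auto
qed

end
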